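(* Let $p\in\mathbb{N}$. Let $P$ be an ergodic transition matrix over a finite space $\mathcal{X}$, and $P^p$ its $p$th power. Let $t_{\mathsf{mix}}$ and $\kappa_\star$ be the mixing time and the generalized contraction coefficient of $P$, and let $\kappa_\star^{(p)}$ be the generalized contraction coefficient of $P^p$. \begin{enumerate} \item[(i)] It holds that $1-\kappa_\star^{(p)} \le p(1-\kappa_\star)$. \item[(ii)] When $p\ge t_{\mathsf{mix}}$, $1-\kappa_\star^{(p)}\ge 1/2$. \item[(iii)] With the universal constant $c_\star = \frac{1}{4\log(4e)} = 0.10476\dots$, when $p\le t_{\mathsf{mix}}$, $1-\kappa_\star^{(p)} \ge c_\star\, p(1-\kappa_\star)$. \end{enumerate}
   Context: $\mathbb{N}=\{1,2,\dots\}$ and $\log$ is the natural logarithm. A row-stochastic matrix $P$ over a finite set $\mathcal{X}$ is ergodic if it is primitive ($P^q>0$ entrywise for some $q\in\mathbb{N}$); it then has a unique stationary distribution $\pi$. Distributions are row vectors, $\|\mu-\nu\|_{\mathsf{TV}}=\frac12\sum_x|\mu(x)-\nu(x)|$. The mixing time is $t_{\mathsf{mix}} = \min\{t\in\mathbb{N}: \sup_{\mu}\|\mu P^t-\pi\|_{\mathsf{TV}}<1/4\}$, the supremum being over probability distributions $\mu$ on $\mathcal{X}$. For an ergodic transition matrix $Q$ over $\mathcal X$ and $s\in\mathbb{N}$, $\kappa_s(Q)=\max_{\mu,\nu}\|\mu Q^s-\nu Q^s\|_{\mathsf{TV}}$ over pairs of probability distributions, and the generalized contraction coefficient of $Q$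 is $\kappa_\star(Q)=1-\max_{s\in\mathbb{N}}\left\{\frac{1-\kappa_s(Q)}{s}\right\}$. *)

theory Defs
  imports "HOL-Analysis.Analysis"
begin

text \<open>
  The finite state space is the (nonempty) index type \<open>'x\<close>. The entry \<open>P $ x $ y\<close> is the transition
  probability from \<open>x\<close> to \<open>y\<close>; distributions are row vectors and act by \<open>\<mu> v* P\<close>.
  The set of positive integers is written \<open>{1..} :: nat set\<close>.
\<close>

definition distribution :: "real ^ 'x::finite \<Rightarrow> bool" where
  "distribution \<mu> \<longleftrightarrow> (\<forall>x. 0 \<le> \<mu> $ x) \<and> (\<Sum>x\<in>UNIV. \<mu> $ x) = 1"

definition row_stochastic :: "real ^ 'x ^ 'x::finite \<Rightarrow> bool" where
  "row_stochastic P \<longleftrightarrow> (\<forall>x. distribution (row x P))"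

text \<open>
  Iterated matrix product. The notation \<open>P ^ n\<close> is not used because multiplication on the type
  \<open>real ^ 'x ^ 'x\<close> is entrywise.
\<close>

primrec mat_power :: "real ^ 'x ^ 'x::finite \<Rightarrow> nat \<Rightarrow> real ^ 'x ^ 'x" where
  "mat_power P 0 = mat 1"
| "mat_power P (Suc n) = P ** mat_power P n"

definition ergodic :: "real ^ 'x ^ 'x::finite \<Rightarrow> bool" where
  "ergodic P \<longleftrightarrow> row_stochastic P \<and> (\<exists>q\<ge>1. \<forall>x y. 0 < mat_power P q $ x $ y)"

text \<open>Well defined only when there is exactly one such distribution, as for ergodic \<open>P\<close>.\<close>

definition stationary_distribution :: "real ^ 'x ^ 'x::finite \<Rightarrow> real ^ 'x" where
  "stationary_distribution P = (THE \<pi>. distribution \<pi> \<and> \<pi> v* P = \<pi>)"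

definition tv_dist :: "real ^ 'x::finite \<Rightarrow> real ^ 'x \<Rightarrow> real" where
  "tv_dist \<mu> \<nu> = (1/2) * (\<Sum>x\<in>UNIV. \<bar>\<mu> $ x - \<nu> $ x\<bar>)"

text \<open>For ergodic \<open>P\<close> the set of admissible \<open>t\<close> is nonempty, so \<open>LEAST\<close> is the minimum.\<close>

definition mixing_time :: "real ^ 'x ^ 'x::finite \<Rightarrow> nat" where
  "mixing_time P = (LEAST t. 1 \<le> t \<and>
     (SUP \<mu>\<in>{\<mu>. distribution \<mu>}. tv_dist (\<mu> v* mat_power P t) (stationary_distribution P)) < 1/4)"

text \<open>
  The two maxima below are written as suprema. For row-stochastic \<open>Q\<close> both are attained:
  the first by compactness of the set of distributions and continuity, the second because
  \<open>0 \<le> (1 - contraction_coeff s Q) / s \<le> 1 / s\<close>, which tends to \<open>0\<close>.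
\<close>

definition contraction_coeff :: "nat \<Rightarrow> real ^ 'x ^ 'x::finite \<Rightarrow> real" where
  "contraction_coeff s Q =
     (SUP (\<mu>, \<nu>)\<in>{\<mu>. distribution \<mu>} \<times> {\<nu>. distribution \<nu>}.
        tv_dist (\<mu> v* mat_power Q s) (\<nu> v* mat_power Q s))"

definition gen_contraction_coeff :: "real ^ 'x ^ 'x::finite \<Rightarrow> real" where
  "gen_contraction_coeff Q = 1 - (SUP s\<in>{1..}. (1 - contraction_coeff s Q) / real s)"

definition c_star :: real where
  "c_star = 1 / (4 * ln (4 * exp 1))"

end

theory Submission
  imports Defs
begin

text \<open>
  Let \<open>K s\<close> be the contraction coefficient of \<open>P\<^sup>s\<close>; it is decreasing and submultiplicative, and
  the coefficients of the powers of \<open>P\<^sup>p\<close> are the numbers \<open>K (p * s)\<close>, which gives (i).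
  For (ii) and (iii), let \<open>T\<close> be the mixing time, \<open>L = ln (4 * exp 1)\<close> and \<open>G m = (1 - K m) / m\<close>.
  The triangle inequality gives \<open>K T < 1/2\<close>; minimality of \<open>T\<close> and stationarity give
  \<open>K (T - 1) \<ge> 1/4\<close> (for \<open>T > 1\<close>), whence for \<open>m < T\<close>
  \<open>(1 - m * G m) ^ \<lfloor>(T - 1) / m\<rfloor> \<ge> 1/4\<close> and \<open>T * G m \<le> L\<close>.
  If \<open>m \<ge> p\<close>, taking \<open>s = \<lceil>m / p\<rceil>\<close> yields \<open>(1 - K (p * s)) / s \<ge> p * G m / 2\<close>.
  If \<open>m < p \<le> T\<close>, then \<open>K p \<le> exp (- u / 2)\<close> for \<open>u = p * G m \<le> L\<close>, and
  \<open>1 - exp (- u / 2) \<ge> u / (2 + u) \<ge> u / (4 * L)\<close>.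
\<close>

section \<open>Distributions and stochastic matrices\<close>

lemma distribution_vector_matrix_mult:
  assumes "row_stochastic Q" "distribution \<mu>"
  shows "distribution (\<mu> v* Q)"
proof -
  have nonneg: "0 \<le> Q $ x $ y" and row_sum: "(\<Sum>y\<in>UNIV. Q $ x $ y) = 1" for x y
    using assms(1) by (auto simp: row_stochastic_def distribution_def row_def)
  have "(\<Sum>y\<in>UNIV. \<Sum>x\<in>UNIV. \<mu> $ x * Q $ x $ y) = (\<Sum>x\<in>UNIV. \<Sum>y\<in>UNIV. \<mu> $ x * Q $ x $ y)"
    by (rule sum.swap)
  also have "\<dots> = 1"
    using assms(2) by (simp add: sum_distrib_left[symmetric] row_sum distribution_def)
  finally show ?thesis
    using assms(2) nonneg by (auto simp: distribution_def vector_matrix_mult_def intro!: sum_nonneg)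
qed

lemma row_stochastic_mat_1: "row_stochastic (mat 1)"
  by (auto simp: row_stochastic_def distribution_def row_def mat_def)

lemma row_stochastic_mult:
  assumes "row_stochastic P" "row_stochastic Q"
  shows "row_stochastic (P ** Q)"
proof -
  have "row x (P ** Q) = row x P v* Q" for x
    by (simp add: row_def matrix_matrix_mult_def vector_matrix_mult_def)
  then show ?thesis
    using assms distribution_vector_matrix_mult[OF assms(2)] by (simp add: row_stochastic_def)
qed

lemma row_stochastic_mat_power: "row_stochastic P \<Longrightarrow> row_stochastic (mat_power P n)"
  by (induction n) (auto simp: row_stochastic_mat_1 row_stochastic_mult)

lemma mat_power_add: "mat_power P (m + n) = mat_power P m ** mat_power P n"
  by (induction m) (auto simp: matrix_mul_assoc)

lemma mat_power_mult: "mat_power P (m * n) = mat_power (mat_power P m) n"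
  by (induction n) (auto simp: mat_power_add)

lemma distribution_ex: "\<exists>\<mu> :: real ^ 'x::finite. distribution \<mu>"
  using row_stochastic_mat_1 by (auto simp: row_stochastic_def)

lemma distribution_le_1: "distribution \<mu> \<Longrightarrow> \<mu> $ x \<le> 1"
  unfolding distribution_def by (metis UNIV_I finite member_le_sum)

lemma compact_distributions: "compact {\<mu> :: real ^ 'x::finite. distribution \<mu>}"
proof (rule compact_Int_closed[of "cbox 0 1" "{\<mu>. distribution \<mu>}", THEN back_subst[of compact]])
  show "closed {\<mu> :: real ^ 'x. distribution \<mu>}"
    unfolding distribution_def
    by (intro closed_Collect_conj closed_Collect_all closed_Collect_le closed_Collect_eq
        continuous_intros)
  show "cbox 0 1 \<inter> {\<mu>. distribution \<mu>} = {\<mu> :: real ^ 'x. distribution \<mu>}"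
    using distribution_le_1 by (fastforce simp: mem_box_cart distribution_def)
qed (rule compact_cbox)

lemma convex_distributions: "convex {\<mu> :: real ^ 'x::finite. distribution \<mu>}"
  by (auto simp: convex_def distribution_def sum.distrib sum_distrib_left[symmetric])

lemma stationary_distribution_ex:
  fixes P :: "real ^ 'x ^ 'x::finite"
  assumes "row_stochastic P"
  obtains \<pi> where "distribution \<pi>" "\<pi> v* P = \<pi>"
proof (rule brouwer[of "{\<mu> :: real ^ 'x. distribution \<mu>}" "\<lambda>\<mu>. \<mu> v* P"])
  show "continuous_on {\<mu>. distribution \<mu>} (\<lambda>\<mu>. \<mu> v* P)"
    unfolding vector_matrix_mult_def by (intro continuous_intros)
qed (use assms that in \<open>auto simp: compact_distributions convex_distributions distribution_ex
      distribution_vector_matrix_mult\<close>)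

lemma stationary_mat_power: "\<pi> v* P = \<pi> \<Longrightarrow> \<pi> v* mat_power P n = \<pi>"
  by (induction n) (auto simp: vector_matrix_mul_assoc[symmetric])

section \<open>Total variation distance\<close>

lemma tv_dist_commute: "tv_dist \<mu> \<nu> = tv_dist \<nu> \<mu>"
  by (simp add: tv_dist_def abs_minus_commute)

lemma tv_dist_self [simp]: "tv_dist \<mu> \<mu> = 0"
  by (simp add: tv_dist_def)

lemma tv_dist_nonneg: "0 \<le> tv_dist \<mu> \<nu>"
  by (simp add: tv_dist_def sum_nonneg)

lemma tv_dist_eq_0_iff: "tv_dist \<mu> \<nu> = 0 \<longleftrightarrow> \<mu> = \<nu>"
  by (simp add: tv_dist_def sum_nonneg_eq_0_iff vec_eq_iff)

lemma tv_dist_triangle: "tv_dist \<mu> \<rho> \<le> tv_dist \<mu> \<nu> + tv_dist \<nu> \<rho>"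
  by (auto simp: tv_dist_def distrib_left[symmetric] sum.distrib[symmetric] intro!: sum_mono)

lemma tv_dist_le_1_minus:
  fixes \<mu> \<nu> :: "real ^ 'x::finite"
  assumes "distribution \<mu>" "distribution \<nu>" and e: "\<And>x. e \<le> \<mu> $ x" "\<And>x. e \<le> \<nu> $ x"
  shows "tv_dist \<mu> \<nu> \<le> 1 - real CARD('x) * e"
proof -
  have "(\<Sum>x\<in>UNIV. \<bar>\<mu> $ x - \<nu> $ x\<bar>) \<le> (\<Sum>x\<in>UNIV. \<mu> $ x + \<nu> $ x - 2 * e)"
    by (intro sum_mono) (smt (verit) e)
  also have "\<dots> = 2 - 2 * real CARD('x) * e"
    using assms(1,2) by (simp add: sum.distrib sum_subtractf distribution_def)
  finally show ?thesis by (simp add: tv_dist_def)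
qed

lemma tv_dist_le_1: "distribution \<mu> \<Longrightarrow> distribution \<nu> \<Longrightarrow> tv_dist \<mu> \<nu> \<le> 1"
  using tv_dist_le_1_minus[of \<mu> \<nu> 0] by (auto simp: distribution_def)

text \<open>The normalised positive and negative parts of the difference.\<close>

lemma distribution_diff_decompose:
  fixes \<mu> \<nu> :: "real ^ 'x::finite"
  assumes "distribution \<mu>" "distribution \<nu>"
  obtains \<mu>' \<nu>' where "distribution \<mu>'" "distribution \<nu>'" "\<mu> - \<nu> = tv_dist \<mu> \<nu> *\<^sub>R (\<mu>' - \<nu>')"
proof (cases "\<mu> = \<nu>")
  case True
  then show ?thesis using that[of \<mu> \<mu>] assms by simp
next
  case False
  define c where "c = tv_dist \<mu> \<nu>"
  have c: "c > 0" using False tv_dist_nonneg[of \<mu> \<nu>] tv_dist_eq_0_iff[of \<mu> \<nu>] by (simp add: c_def)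
  define A where "A = (\<Sum>x\<in>UNIV. max 0 (\<mu> $ x - \<nu> $ x))"
  define B where "B = (\<Sum>x\<in>UNIV. max 0 (\<nu> $ x - \<mu> $ x))"
  have "A - B = (\<Sum>x\<in>UNIV. \<mu> $ x - \<nu> $ x)"
    unfolding A_def B_def sum_subtractf[symmetric] by (intro sum.cong) auto
  moreover have "\<dots> = 0"
    using assms by (simp add: sum_subtractf distribution_def)
  moreover have "A + B = 2 * c"
    unfolding A_def B_def c_def tv_dist_def sum.distrib[symmetric] by (auto intro!: sum.cong)
  ultimately have AB: "A = c" "B = c" by auto
  show ?thesis
  proof (rule that[of "\<chi> x. max 0 (\<mu> $ x - \<nu> $ x) / c" "\<chi> x. max 0 (\<nu> $ x - \<mu> $ x) / c"])
    show "distribution (\<chi> x. max 0 (\<mu> $ x - \<nu> $ x) / c)"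
      using AB c by (auto simp: distribution_def A_def sum_divide_distrib[symmetric])
    show "distribution (\<chi> x. max 0 (\<nu> $ x - \<mu> $ x) / c)"
      using AB c by (auto simp: distribution_def B_def sum_divide_distrib[symmetric])
    show "\<mu> - \<nu> = tv_dist \<mu> \<nu> *\<^sub>R ((\<chi> x. max 0 (\<mu> $ x - \<nu> $ x) / c)
        - (\<chi> x. max 0 (\<nu> $ x - \<mu> $ x) / c))"
      using c by (auto simp: vec_eq_iff c_def[symmetric] field_simps max_def)
  qed
qed

section \<open>Contraction coefficients\<close>

lemma tv_dist_le_contraction_coeff:
  assumes "row_stochastic P" "distribution \<mu>" "distribution \<nu>"
  shows "tv_dist (\<mu> v* mat_power P s) (\<nu> v* mat_power P s) \<le> contraction_coeff s P"
proof -
  let ?f = "\<lambda>(\<mu>, \<nu>). tv_dist (\<mu> v* mat_power P s) (\<nu> v* mat_power P s)"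
  have "bdd_above (?f ` ({\<mu>. distribution \<mu>} \<times> {\<nu>. distribution \<nu>}))"
    using assms(1) by (intro bdd_aboveI2[where M=1])
      (auto intro!: tv_dist_le_1 distribution_vector_matrix_mult row_stochastic_mat_power)
  from cSUP_upper[OF _ this, of "(\<mu>, \<nu>)"] show ?thesis
    using assms by (simp add: contraction_coeff_def)
qed

lemma contraction_coeff_le:
  assumes "\<And>\<mu> \<nu>. distribution \<mu> \<Longrightarrow> distribution \<nu> \<Longrightarrow>
    tv_dist (\<mu> v* mat_power P s) (\<nu> v* mat_power P s) \<le> c"
  shows "contraction_coeff s P \<le> c"
  unfolding contraction_coeff_def using assms distribution_ex
  by (intro cSUP_least) auto

lemma contraction_coeff_nonneg: "row_stochastic P \<Longrightarrow> 0 \<le> contraction_coeff s P"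
  by (metis distribution_ex tv_dist_le_contraction_coeff tv_dist_self)

lemma contraction_coeff_le_1: "row_stochastic P \<Longrightarrow> contraction_coeff s P \<le> 1"
  by (intro contraction_coeff_le tv_dist_le_1 distribution_vector_matrix_mult
      row_stochastic_mat_power)

lemma tv_dist_contract:
  assumes "row_stochastic P" "distribution \<mu>" "distribution \<nu>"
  shows "tv_dist (\<mu> v* mat_power P s) (\<nu> v* mat_power P s) \<le> tv_dist \<mu> \<nu> * contraction_coeff s P"
proof -
  let ?Q = "mat_power P s"
  obtain \<mu>' \<nu>' where *: "distribution \<mu>'" "distribution \<nu>'" "\<mu> - \<nu> = tv_dist \<mu> \<nu> *\<^sub>R (\<mu>' - \<nu>')"
    using distribution_diff_decompose assms(2,3) by blast
  have "\<mu> v* ?Q - \<nu> v* ?Q = tv_dist \<mu> \<nu> *\<^sub>R (\<mu>' v* ?Q - \<nu>' v* ?Q)"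
    by (simp only: vector_matrix_mult_diff_distrib[symmetric]
        scaleR_vector_matrix_assoc[symmetric] *(3))
  then have "(\<mu> v* ?Q) $ x - (\<nu> v* ?Q) $ x = tv_dist \<mu> \<nu> * ((\<mu>' v* ?Q) $ x - (\<nu>' v* ?Q) $ x)" for x
    by (simp only: vec_eq_iff vector_minus_component vector_scaleR_component real_scaleR_def)
  then have "tv_dist (\<mu> v* ?Q) (\<nu> v* ?Q) = tv_dist \<mu> \<nu> * tv_dist (\<mu>' v* ?Q) (\<nu>' v* ?Q)"
    using tv_dist_nonneg[of \<mu> \<nu>]
    by (simp add: tv_dist_def[of "_ v* _"] abs_mult sum_distrib_left mult.left_commute)
  also have "\<dots> \<le> tv_dist \<mu> \<nu> * contraction_coeff s P"
    using assms(1) * by (intro mult_left_mono tv_dist_le_contraction_coeff tv_dist_nonneg)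
  finally show ?thesis .
qed

lemma contraction_coeff_add:
  assumes "row_stochastic P"
  shows "contraction_coeff (s + t) P \<le> contraction_coeff s P * contraction_coeff t P"
proof (rule contraction_coeff_le)
  fix \<mu> \<nu> :: "real ^ 'a"
  assume \<mu>\<nu>: "distribution \<mu>" "distribution \<nu>"
  have "tv_dist (\<mu> v* mat_power P (s + t)) (\<nu> v* mat_power P (s + t))
      \<le> tv_dist (\<mu> v* mat_power P s) (\<nu> v* mat_power P s) * contraction_coeff t P"
    unfolding mat_power_add vector_matrix_mul_assoc[symmetric] using assms \<mu>\<nu>
    by (intro tv_dist_contract distribution_vector_matrix_mult row_stochastic_mat_power)
  also have "\<dots> \<le> contraction_coeff s P * contraction_coeff t P"
    using assms \<mu>\<nu> by (intro mult_right_mono tv_dist_le_contraction_coeff contraction_coeff_nonneg)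
  finally show "tv_dist (\<mu> v* mat_power P (s + t)) (\<nu> v* mat_power P (s + t))
      \<le> contraction_coeff s P * contraction_coeff t P" .
qed

lemma contraction_coeff_antimono:
  assumes "row_stochastic P" "s \<le> t"
  shows "contraction_coeff t P \<le> contraction_coeff s P"
proof -
  have "contraction_coeff t P \<le> contraction_coeff s P * contraction_coeff (t - s) P"
    using contraction_coeff_add[OF assms(1), of s "t - s"] assms(2) by simp
  also have "\<dots> \<le> contraction_coeff s P"
    using assms(1) by (intro mult_left_le contraction_coeff_le_1 contraction_coeff_nonneg)
  finally show ?thesis .
qed

lemma contraction_coeff_mult_le_power:
  assumes "row_stochastic P"
  shows "contraction_coeff (s * k) P \<le> contraction_coeff s P ^ k"
proof (induction k)
  case 0
  show ?case using assms by (simp add: contraction_coeff_le_1)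
next
  case (Suc k)
  have "contraction_coeff (s * Suc k) P \<le> contraction_coeff s P * contraction_coeff (s * k) P"
    using contraction_coeff_add[OF assms] by simp
  also have "\<dots> \<le> contraction_coeff s P * contraction_coeff s P ^ k"
    using Suc assms by (intro mult_left_mono contraction_coeff_nonneg)
  finally show ?case by simp
qed

lemma contraction_coeff_le_power_div:
  assumes "row_stochastic P"
  shows "contraction_coeff t P \<le> contraction_coeff s P ^ (t div s)"
  using contraction_coeff_antimono[OF assms, of "s * (t div s)" t]
    contraction_coeff_mult_le_power[OF assms, of s "t div s"] by simp

lemma contraction_coeff_mat_power:
  "contraction_coeff s (mat_power P p) = contraction_coeff (p * s) P"
  by (simp add: contraction_coeff_def mat_power_mult)

lemma contraction_rate_le:
  assumes "row_stochastic P" "1 \<le> s"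
  shows "(1 - contraction_coeff s P) / real s \<le> 1 - gen_contraction_coeff P"
proof -
  have "(1 - contraction_coeff s P) / real s \<le> 1" if "1 \<le> s" for s
    using that contraction_coeff_nonneg[OF assms(1), of s] by (simp add: divide_le_eq)
  then have "bdd_above ((\<lambda>s. (1 - contraction_coeff s P) / real s) ` {1..})"
    by (intro bdd_aboveI2[where M=1]) auto
  from cSUP_upper[OF _ this, of s] show ?thesis
    using assms(2) by (simp add: gen_contraction_coeff_def)
qed

lemma contraction_rates_bound:
  assumes "\<And>s. 1 \<le> s \<Longrightarrow> (1 - contraction_coeff s P) / real s \<le> c"
  shows "1 - gen_contraction_coeff P \<le> c"
proof -
  have "(SUP s\<in>{1..}. (1 - contraction_coeff s P) / real s) \<le> c"
    using assms by (intro cSUP_least) auto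
  then show ?thesis by (simp add: gen_contraction_coeff_def)
qed

section \<open>Ergodic matrices and the mixing time\<close>

lemma ergodic_contraction_coeff_less_1:
  fixes P :: "real ^ 'x ^ 'x::finite"
  assumes "ergodic P"
  obtains q where "contraction_coeff q P < 1"
proof -
  obtain q where pos: "\<And>x y. 0 < mat_power P q $ x $ y" and P: "row_stochastic P"
    using assms by (auto simp: ergodic_def)
  define e where "e = Min (range (\<lambda>(x, y). mat_power P q $ x $ y))"
  have "e \<in> range (\<lambda>(x, y). mat_power P q $ x $ y)"
    unfolding e_def by (intro Min_in) auto
  then have "e > 0" using pos by auto
  have e: "e \<le> mat_power P q $ x $ y" for x y
    unfolding e_def by (intro Min_le) auto
  have lower: "e \<le> (\<mu> v* mat_power P q) $ y" if "distribution \<mu>" for \<mu> y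
  proof -
    have "e = (\<Sum>x\<in>UNIV. \<mu> $ x * e)"
      using that by (simp add: distribution_def sum_distrib_right[symmetric])
    also have "\<dots> \<le> (\<Sum>x\<in>UNIV. \<mu> $ x * mat_power P q $ x $ y)"
      using that e by (intro sum_mono mult_left_mono) (auto simp: distribution_def)
    finally show ?thesis by (simp add: vector_matrix_mult_def)
  qed
  have "contraction_coeff q P \<le> 1 - real CARD('x) * e"
    using P by (intro contraction_coeff_le tv_dist_le_1_minus lower
        distribution_vector_matrix_mult row_stochastic_mat_power)
  also have "\<dots> < 1" using \<open>e > 0\<close> by simp
  finally show ?thesis using that by blast
qed

lemma stationary_distribution:
  fixes P :: "real ^ 'x ^ 'x::finite"
  assumes "ergodic P"
  shows "distribution (stationary_distribution P)"
    and "stationary_distribution P v* P = stationary_distribution P"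
proof -
  have P: "row_stochastic P" using assms by (simp add: ergodic_def)
  obtain q where q: "contraction_coeff q P < 1"
    using ergodic_contraction_coeff_less_1 assms by blast
  have "\<exists>!\<pi>. distribution \<pi> \<and> \<pi> v* P = \<pi>"
  proof (rule ex_ex1I)
    show "\<exists>\<pi>. distribution \<pi> \<and> \<pi> v* P = \<pi>"
      using stationary_distribution_ex[OF P] by blast
  next
    fix \<pi> \<pi>'
    assume *: "distribution \<pi> \<and> \<pi> v* P = \<pi>" "distribution \<pi>' \<and> \<pi>' v* P = \<pi>'"
    then have "tv_dist \<pi> \<pi>' \<le> tv_dist \<pi> \<pi>' * contraction_coeff q P"
      using tv_dist_contract[OF P, of \<pi> \<pi>' q] by (simp add: stationary_mat_power)
    then have "tv_dist \<pi> \<pi>' = 0"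
      using q tv_dist_nonneg[of \<pi> \<pi>'] by (smt (verit) mult_less_cancel_left2)
    then show "\<pi> = \<pi>'" by (simp add: tv_dist_eq_0_iff)
  qed
  from theI'[OF this]
  show "distribution (stationary_distribution P)"
    "stationary_distribution P v* P = stationary_distribution P"
    by (auto simp: stationary_distribution_def)
qed

definition mixing_distance :: "real ^ 'x ^ 'x::finite \<Rightarrow> nat \<Rightarrow> real" where
  "mixing_distance P t =
     (SUP \<mu>\<in>{\<mu>. distribution \<mu>}. tv_dist (\<mu> v* mat_power P t) (stationary_distribution P))"

lemma mixing_time_eq: "mixing_time P = (LEAST t. 1 \<le> t \<and> mixing_distance P t < 1/4)"
  by (simp add: mixing_time_def mixing_distance_def)

lemma mixing_distance_le_contraction_coeff:
  assumes "ergodic P"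
  shows "mixing_distance P t \<le> contraction_coeff t P"
  unfolding mixing_distance_def
proof (rule cSUP_least)
  fix \<mu> :: "real ^ 'a"
  assume "\<mu> \<in> {\<mu>. distribution \<mu>}"
  then show "tv_dist (\<mu> v* mat_power P t) (stationary_distribution P) \<le> contraction_coeff t P"
    using tv_dist_le_contraction_coeff[of P \<mu> "stationary_distribution P" t] assms
      stationary_distribution[OF assms]
    by (simp add: stationary_mat_power ergodic_def)
qed (use distribution_ex in auto)

lemma contraction_coeff_le_mixing_distance:
  assumes "ergodic P"
  shows "contraction_coeff t P \<le> 2 * mixing_distance P t"
proof (rule contraction_coeff_le)
  fix \<mu> \<nu> :: "real ^ 'a"
  assume \<mu>\<nu>: "distribution \<mu>" "distribution \<nu>"
  let ?\<pi> = "stationary_distribution P"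
  have "bdd_above ((\<lambda>\<mu>. tv_dist (\<mu> v* mat_power P t) ?\<pi>) ` {\<mu>. distribution \<mu>})"
    using assms stationary_distribution[OF assms]
    by (intro bdd_aboveI2[where M=1])
      (auto simp: ergodic_def intro!: tv_dist_le_1 distribution_vector_matrix_mult
        row_stochastic_mat_power)
  then have "tv_dist (\<rho> v* mat_power P t) ?\<pi> \<le> mixing_distance P t" if "distribution \<rho>" for \<rho>
    unfolding mixing_distance_def using that by (intro cSUP_upper) auto
  from this[OF \<mu>\<nu>(1)] this[OF \<mu>\<nu>(2)]
  show "tv_dist (\<mu> v* mat_power P t) (\<nu> v* mat_power P t) \<le> 2 * mixing_distance P t"
    using tv_dist_triangle[of "\<mu> v* mat_power P t" "\<nu> v* mat_power P t" ?\<pi>]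
    by (simp add: tv_dist_commute)
qed

lemma mixing_time_ge_1: "ergodic P \<Longrightarrow> 1 \<le> mixing_time P"
  and mixing_distance_mixing_time: "ergodic P \<Longrightarrow> mixing_distance P (mixing_time P) < 1/4"
proof -
  assume P: "ergodic P"
  have stoch: "row_stochastic P" using P by (simp add: ergodic_def)
  obtain q where q: "contraction_coeff q P < 1"
    using ergodic_contraction_coeff_less_1 P by blast
  obtain k where k: "contraction_coeff q P ^ k < 1/4"
    using real_arch_pow_inv[OF _ q, of "1/4"] by auto
  have "mixing_distance P (q * k + 1) \<le> contraction_coeff (q * k + 1) P"
    by (rule mixing_distance_le_contraction_coeff[OF P])
  also have "\<dots> \<le> contraction_coeff (q * k) P"
    using stoch by (intro contraction_coeff_antimono) auto
  also have "\<dots> < 1/4"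
    using contraction_coeff_mult_le_power[OF stoch, of q k] k by simp
  finally have "1 \<le> q * k + 1 \<and> mixing_distance P (q * k + 1) < 1/4" by simp
  from LeastI[of "\<lambda>t. 1 \<le> t \<and> mixing_distance P t < 1/4", OF this]
  show "1 \<le> mixing_time P" "mixing_distance P (mixing_time P) < 1/4"
    by (simp_all add: mixing_time_eq)
qed

lemma contraction_coeff_ge_mixing_time:
  assumes "ergodic P" "mixing_time P \<le> p"
  shows "contraction_coeff p P < 1/2"
proof -
  have "contraction_coeff p P \<le> contraction_coeff (mixing_time P) P"
    using assms by (intro contraction_coeff_antimono) (auto simp: ergodic_def)
  then show ?thesis
    using contraction_coeff_le_mixing_distance[OF assms(1), of "mixing_time P"]
      mixing_distance_mixing_time[OF assms(1)] by simp
qed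

lemma contraction_coeff_less_mixing_time:
  assumes "ergodic P" "1 \<le> t" "t < mixing_time P"
  shows "1/4 \<le> contraction_coeff t P"
  using not_less_Least[of t "\<lambda>t. 1 \<le> t \<and> mixing_distance P t < 1/4"] assms
    mixing_distance_le_contraction_coeff[OF assms(1), of t]
  by (simp add: mixing_time_eq)

section \<open>Comparison of the contraction rates\<close>

lemma c_star_bounds: "0.10476 \<le> c_star" "c_star < 0.10477"
proof -
  have "ln (4 :: real) = 2 * ln 2"
    using ln_realpow[of "2::real" 2] by simp
  then have c: "c_star = 1 / (4 * (1 + 2 * ln 2))"
    by (simp add: c_star_def ln_mult)
  have "ln (2::real) > 69312/100000" "ln (2::real) < 69318/100000"
    using ln_approx_bounds[of 2 4] by (simp_all add: lessThan_nat_numeral lessThan_Suc eval_nat_numeral)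
  then show "0.10476 \<le> c_star" "c_star < 0.10477"
    unfolding c by (simp_all add: field_simps)
qed

lemma one_minus_power_le_exp:
  fixes a :: real
  assumes "0 \<le> a" "a \<le> 1"
  shows "(1 - a) ^ k \<le> exp (- (a * real k))"
proof -
  have "(1 - a) ^ k \<le> exp (- a) ^ k"
    using assms exp_ge_add_one_self[of "- a"] by (intro power_mono) auto
  then show ?thesis by (simp add: exp_of_nat_mult[symmetric] mult.commute)
qed

lemma mixing_time_times_rate_le:
  assumes P: "ergodic P" and m: "1 \<le> m" "m < mixing_time P"
  shows "real (mixing_time P) * ((1 - contraction_coeff m P) / real m) \<le> 1 + ln 4"
proof -
  define T where "T = mixing_time P"
  define a where "a = 1 - contraction_coeff m P"
  define k where "k = (T - 1) div m"
  have stoch: "row_stochastic P" using P by (simp add: ergodic_def)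
  have a: "0 \<le> a" "a \<le> 1"
    using contraction_coeff_nonneg[OF stoch, of m] contraction_coeff_le_1[OF stoch, of m]
    by (auto simp: a_def)
  have "1/4 \<le> contraction_coeff (T - 1) P"
    using m P by (intro contraction_coeff_less_mixing_time) (auto simp: T_def)
  also have "\<dots> \<le> (1 - a) ^ k"
    using contraction_coeff_le_power_div[OF stoch, of "T - 1" m] by (simp add: a_def k_def)
  also have "\<dots> \<le> exp (- (a * real k))"
    using a by (rule one_minus_power_le_exp)
  finally have "ln (1/4) \<le> - (a * real k)"
    using ln_le_cancel_iff[of "1/4" "exp (- (a * real k))"] by simp
  then have ak: "a * real k \<le> ln 4" by (simp add: ln_div)
  have "T - 1 < m * (k + 1)"
    using m dividend_less_times_div[of m "T - 1"] by (simp add: k_def)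
  then have "T \<le> m * (k + 1)" by simp
  then have "real T \<le> real m * (real k + 1)"
    by (metis of_nat_le_iff of_nat_mult of_nat_add of_nat_1)
  then have "real T * a \<le> real m * (real k + 1) * a"
    using a by (intro mult_right_mono)
  also have "\<dots> = real m * (a * real k + a)" by (simp add: algebra_simps)
  also have "\<dots> \<le> real m * (1 + ln 4)"
    using ak a by (intro mult_left_mono) auto
  finally show ?thesis
    using m by (simp add: T_def a_def field_simps)
qed

lemma rate_power_ge_of_le:
  assumes P: "row_stochastic P" and p: "1 \<le> p" "p \<le> m"
  shows "real p * ((1 - contraction_coeff m P) / real m) / 2
    \<le> 1 - gen_contraction_coeff (mat_power P p)"
proof -
  define a where "a = 1 - contraction_coeff m P"
  define s where "s = (m - 1) div p + 1"
  have a: "0 \<le> a" using contraction_coeff_le_1[OF P, of m] by (simp add: a_def)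
  have "m - 1 < p * s"
    using p dividend_less_times_div[of p "m - 1"] by (simp add: s_def)
  then have "m \<le> p * s" by simp
  have "p * s = p * ((m - 1) div p) + p" by (simp add: s_def)
  then have "p * s \<le> 2 * m"
    using p times_div_less_eq_dividend[of p "m - 1"] by linarith
  then have ps: "real p * real s \<le> 2 * real m"
    by (metis of_nat_le_iff of_nat_mult of_nat_numeral)
  have "real p * (a / real m) / 2 \<le> a / real s"
    using mult_left_mono[OF ps a] p by (simp add: s_def field_simps)
  also have "\<dots> \<le> (1 - contraction_coeff (p * s) P) / real s"
    using contraction_coeff_antimono[OF P \<open>m \<le> p * s\<close>] by (intro divide_right_mono) (auto simp: a_def)
  also have "\<dots> \<le> 1 - gen_contraction_coeff (mat_power P p)"
    using contraction_rate_le[OF row_stochastic_mat_power[OF P], of s p]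
    by (simp add: contraction_coeff_mat_power s_def)
  finally show ?thesis by (simp add: a_def)
qed

lemma rate_power_ge_of_less:
  assumes P: "ergodic P" and m: "1 \<le> m" "m < p" and p: "p \<le> mixing_time P"
  shows "c_star * real p * ((1 - contraction_coeff m P) / real m)
    \<le> 1 - gen_contraction_coeff (mat_power P p)"
proof -
  define a where "a = 1 - contraction_coeff m P"
  define u where "u = real p * (a / real m)"
  define L where "L = 1 + ln (4::real)"
  have stoch: "row_stochastic P" using P by (simp add: ergodic_def)
  have a: "0 \<le> a" "a \<le> 1"
    using contraction_coeff_nonneg[OF stoch, of m] contraction_coeff_le_1[OF stoch, of m]
    by (auto simp: a_def)
  have u0: "0 \<le> u" using a by (simp add: u_def)
  have "u \<le> real (mixing_time P) * (a / real m)"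
    unfolding u_def using p a by (intro mult_right_mono) auto
  also have "\<dots> \<le> L"
    unfolding a_def L_def using P m p by (intro mixing_time_times_rate_le) auto
  finally have uL: "u \<le> L" .
  have L1: "1 \<le> L" by (simp add: L_def)
  have "p < m * (p div m + 1)"
    using m dividend_less_times_div[of m p] by simp
  also have "\<dots> \<le> 2 * m * (p div m)"
    using m div_greater_zero_iff[of p m] by (simp add: algebra_simps)
  finally have "real p \<le> 2 * real m * real (p div m)"
    by (metis less_imp_le of_nat_le_iff of_nat_mult of_nat_numeral)
  then have u2: "u / 2 \<le> a * real (p div m)"
    using mult_left_mono[of "real p" "2 * real m * real (p div m)" a] a m by (simp add: u_def field_simps)
  have "contraction_coeff p P \<le> (1 - a) ^ (p div m)"
    using contraction_coeff_le_power_div[OF stoch, of p m] by (simp add: a_def)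
  also have "\<dots> \<le> exp (- (a * real (p div m)))"
    using a by (rule one_minus_power_le_exp)
  also have "\<dots> \<le> exp (- (u / 2))"
    using u2 by simp
  also have "\<dots> \<le> 1 / (1 + u / 2)"
    using u0 exp_ge_add_one_self[of "u / 2"] by (simp add: exp_minus field_simps)
  finally have "1 - 1 / (1 + u / 2) \<le> 1 - contraction_coeff p P" by simp
  moreover have "u / (4 * L) \<le> u / (2 + u)"
    using u0 uL L1 by (intro divide_left_mono) auto
  moreover have "u / (2 + u) = 1 - 1 / (1 + u / 2)"
    using u0 by (simp add: field_simps)
  moreover have "c_star * u = u / (4 * L)"
    by (simp add: c_star_def L_def ln_mult add.commute)
  moreover have "1 - contraction_coeff p P \<le> 1 - gen_contraction_coeff (mat_power P p)"
    using contraction_rate_le[OF row_stochastic_mat_power[OF stoch], of 1 p]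
    by (simp add: contraction_coeff_mat_power)
  ultimately show ?thesis by (simp add: u_def a_def)
qed

theorem proposition2p1:
  fixes P :: "real ^ 'x ^ 'x::finite" and p :: nat
  assumes "1 \<le> p" and "ergodic P"
  shows "1 - gen_contraction_coeff (mat_power P p) \<le> real p * (1 - gen_contraction_coeff P)
    \<and> (mixing_time P \<le> p \<longrightarrow> 1/2 \<le> 1 - gen_contraction_coeff (mat_power P p))
    \<and> (0.10476 \<le> c_star \<and> c_star < 0.10477)
    \<and> (p \<le> mixing_time P \<longrightarrow>
         c_star * real p * (1 - gen_contraction_coeff P) \<le> 1 - gen_contraction_coeff (mat_power P p))"
proof (intro conjI impI c_star_bounds)
  have P: "row_stochastic P" using assms(2) by (simp add: ergodic_def)
  show "1 - gen_contraction_coeff (mat_power P p) \<le> real p * (1 - gen_contraction_coeff P)"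
  proof (rule contraction_rates_bound)
    fix s :: nat
    assume "1 \<le> s"
    then show "(1 - contraction_coeff s (mat_power P p)) / real s
        \<le> real p * (1 - gen_contraction_coeff P)"
      using contraction_rate_le[OF P, of "p * s"] assms(1)
      by (simp add: contraction_coeff_mat_power field_simps)
  qed
  show "1/2 \<le> 1 - gen_contraction_coeff (mat_power P p)" if "mixing_time P \<le> p"
    using contraction_rate_le[OF row_stochastic_mat_power[OF P], of 1 p]
      contraction_coeff_ge_mixing_time[OF assms(2) that]
    by (simp add: contraction_coeff_mat_power)
  assume p: "p \<le> mixing_time P"
  have c: "0 < c_star * real p" using c_star_bounds assms(1) by simp
  have "1 - gen_contraction_coeff P
      \<le> (1 - gen_contraction_coeff (mat_power P p)) / (c_star * real p)"
  proof (rule contraction_rates_bound)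
    fix m :: nat
    assume m: "1 \<le> m"
    define r where "r = (1 - contraction_coeff m P) / real m"
    have r: "0 \<le> r" using contraction_coeff_le_1[OF P, of m] by (simp add: r_def)
    have "c_star * real p * r \<le> 1 - gen_contraction_coeff (mat_power P p)"
    proof (cases "p \<le> m")
      case True
      have "c_star * (real p * r) \<le> 1/2 * (real p * r)"
        using c_star_bounds r by (intro mult_right_mono) auto
      then show ?thesis
        using rate_power_ge_of_le[OF P assms(1) True] by (simp add: r_def)
    next
      case False
      then show ?thesis
        using rate_power_ge_of_less[OF assms(2) m _ p] by (simp add: r_def)
    qed
    then show "(1 - contraction_coeff m P) / real m
        \<le> (1 - gen_contraction_coeff (mat_power P p)) / (c_star * real p)"
      using c by (simp add: r_def pos_le_divide_eq mult.commute)
  qed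
  then show "c_star * real p * (1 - gen_contraction_coeff P)
      \<le> 1 - gen_contraction_coeff (mat_power P p)"
    using c by (simp add: pos_le_divide_eq mult.commute)
qed

end
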